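(* Let $I\subseteq S$ be a proper monomial ideal and let $\mathbf a\succeq\mathbf a_I$. Then $I^{\mathbf a}=I^{[\mathbf a]}$.
   Context: $k$ is a field, $n\ge 2$, $S=k[x_1,\ldots,x_n]\subseteq T=S[x_1^{-1},\ldots,x_n^{-1}]$, $\mathbb Z^n$-graded; $x^{\mathbf a}=x_1^{a_1}\cdots x_n^{a_n}$; $\preceq$ is the coordinatewise partial order on $\mathbb Z^n$. For $\mathbf b\in\mathbb N^n$ put $\mathfrak m^{\mathbf b}=\langle x_i^{b_i}\mid b_i\ge 1\rangle$; these are exactly the irreducible monomial ideals. $\mathbf a_I$ is the exponent vector of the least common multiple of the minimal generators of $I$, and $\mathrm{Irr}(I)$ is the set of irreducible components in the unique irredundant decomposition of $I$ as an intersection of irreducible monomial ideals; $\mathfrak m^{\mathbf b}\in\mathrm{Irr}(I)$ implies $\mathbf b\preceq\mathbf a_I$. For $\mathbf 0\preceq\mathbf b\preceq\mathbf a$ let $\mathbf b^{\mathbf a}$ be the vector with $i$th coordinate $a_i+1-b_i$ if $b_i\ge1$ and $0$ if $b_i=0$. For $\mathbf a\succeq\mathbf a_I$, $I^{\mathbf a}=\langle x^{\mathbf b^{\mathbf a}}\mid \mathfrak m^{\mathbf b}\in\mathrm{Irr}(I)\rangle$. A monomial module is a $\mathbb Z^n$-graded $S$-submodule $M\subseteq T$. Its $T$-dual $M^T\subseteq T$ is the monomial module spanned by the Laurent monomials with $x^{-\mathbf b}\in M^T\Leftrightarrow x^{\mathbf b}\notin M$. The shift is $N[\mathbf a]_{\mathbf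 b}=N_{\mathbf a+\mathbf b}$, so for $M\subseteq T$ the module $M[-\mathbf a]$ is identified with the submodule $x^{\mathbf a}M$ of $T$. The Čech hull of a monomial ideal $I$ is $\widetilde I=\langle x^{\mathbf b}\mid \mathbf b\in\mathbb Z^n,\ x^{\mathbf b^+}\in I\rangle\subseteq T$ where $\mathbf b^+$ is the componentwise maximum of $\mathbf b$ and $\mathbf 0$. For $\mathbf a\succeq\mathbf a_I$ define $I^{[\mathbf a]}=\bigl(\widetilde I\bigr)^{T}[-\mathbf a]\cap S$. *)

theory Defs
  imports
    "HOL-Analysis.Finite_Cartesian_Product"
    "HOL-Analysis.Cartesian_Space"
    "HOL-Library.Poly_Mapping"
    "HOL-Algebra.Ideal"
    "HOL-Algebra.Module"
begin

text \<open>Exponent vectors live in \<open>int ^ 'n\<close> with \<open>n = CARD('n)\<close>; the order on this type is the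
  coordinatewise one. The Laurent polynomial ring \<open>T\<close> is the group algebra of \<open>int ^ 'n\<close>, that is,
  the type \<open>'k laurent\<close> below with its convolution product, and \<open>S\<close> is the subring of those Laurent
  polynomials whose exponents are all nonnegative.\<close>

type_synonym ('k, 'n) laurent = "(int ^ 'n) \<Rightarrow>\<^sub>0 'k"

definition monomial :: "int ^ 'n \<Rightarrow> ('k::field, 'n::finite) laurent" where
  "monomial b = Poly_Mapping.single b 1"

definition polys :: "('k::field, 'n::finite) laurent set" where
  "polys = {p. \<forall>b \<in> Poly_Mapping.keys p. 0 \<le> b}"

definition S_ring :: "('k::field, 'n::finite) laurent ring" where
  "S_ring = \<lparr>carrier = polys, monoid.mult = (*), one = 1, ring.zero = 0, add = (+)\<rparr>"

definition T_module ::
  "(('k::field, 'n::finite) laurent, ('k, 'n) laurent) module" where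
  "T_module = \<lparr>carrier = UNIV, monoid.mult = (*), one = 1, ring.zero = 0, add = (+),
    module.smult = (*)\<rparr>"


subsection \<open>Monomial ideals\<close>

definition monomial_ideal :: "('k::field, 'n::finite) laurent set \<Rightarrow> bool" where
  "monomial_ideal I \<longleftrightarrow> (\<exists>B \<subseteq> {b. 0 \<le> b}. I = Idl\<^bsub>S_ring\<^esub> (monomial ` B))"

text \<open>Exponents of the unique minimal set of monomials generating a monomial ideal.\<close>

definition min_gens :: "('k::field, 'n::finite) laurent set \<Rightarrow> (int ^ 'n) set" where
  "min_gens I = (THE B. B \<subseteq> {b. 0 \<le> b} \<and> Idl\<^bsub>S_ring\<^esub> (monomial ` B) = I \<and>
     (\<forall>C. C \<subset> B \<longrightarrow> Idl\<^bsub>S_ring\<^esub> (monomial ` C) \<noteq> I))"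

text \<open>The exponent vector \<open>a\<^sub>I\<close>. Inserting \<open>0\<close> only matters for \<open>I = 0\<close>, where the least common
  multiple of the empty set of generators is \<open>1\<close>.\<close>

definition lcm_exponent :: "('k::field, 'n::finite) laurent set \<Rightarrow> int ^ 'n" where
  "lcm_exponent I = (\<chi> i. Max (insert 0 ((\<lambda>b. b $ i) ` min_gens I)))"

definition m_pow :: "int ^ 'n \<Rightarrow> ('k::field, 'n::finite) laurent set" where
  "m_pow b = Idl\<^bsub>S_ring\<^esub> {monomial (axis i (b $ i)) | i. 1 \<le> b $ i}"

definition irreducible_ideal :: "('a, 'b) ring_scheme \<Rightarrow> 'a set \<Rightarrow> bool" where
  "irreducible_ideal R J \<longleftrightarrow> ideal J R \<and> J \<noteq> carrier R \<and>
     (\<forall>J1 J2. ideal J1 R \<and> ideal J2 R \<and> J = J1 \<inter> J2 \<longrightarrow> J = J1 \<or> J = J2)"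

text \<open>The intersection with \<open>polys\<close> makes the intersection of the empty family equal to \<open>S\<close>.\<close>

definition irredundant_irreducible_decomposition ::
  "('k::field, 'n::finite) laurent set \<Rightarrow> ('k, 'n) laurent set set \<Rightarrow> bool" where
  "irredundant_irreducible_decomposition I D \<longleftrightarrow>
     finite D \<and> (\<forall>J \<in> D. monomial_ideal J \<and> irreducible_ideal S_ring J) \<and>
     polys \<inter> \<Inter>D = I \<and> (\<forall>J \<in> D. polys \<inter> \<Inter>(D - {J}) \<noteq> I)"

definition Irr :: "('k::field, 'n::finite) laurent set \<Rightarrow> ('k, 'n) laurent set set" where
  "Irr I = (THE D. irredundant_irreducible_decomposition I D)"

definition flip :: "int ^ 'n \<Rightarrow> int ^ 'n \<Rightarrow> int ^ 'n" where
  "flip a b = (\<chi> i. if 1 \<le> b $ i then a $ i + 1 - b $ i else 0)"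

text \<open>The ideal \<open>I\<^sup>a\<close>.\<close>

definition alexander_dual ::
  "('k::field, 'n::finite) laurent set \<Rightarrow> int ^ 'n \<Rightarrow> ('k, 'n) laurent set" where
  "alexander_dual I a = Idl\<^bsub>S_ring\<^esub> (monomial ` {flip a b | b. 0 \<le> b \<and> m_pow b \<in> Irr I})"


subsection \<open>Monomial modules\<close>

definition S_span :: "('k::field, 'n::finite) laurent set \<Rightarrow> ('k, 'n) laurent set" where
  "S_span X = (\<lambda>M. submodule M S_ring T_module) hull X"

definition T_dual :: "('k::field, 'n::finite) laurent set \<Rightarrow> ('k, 'n) laurent set" where
  "T_dual M = S_span {monomial (- b) | b. monomial b \<notin> M}"

text \<open>\<open>N[a]\<^sub>b = N\<^sub>a\<^sub>+\<^sub>b\<close>, so inside \<open>T\<close> the module \<open>N[a]\<close> is \<open>x\<^sup>-\<^sup>a N\<close>.\<close>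

definition shift :: "('k::field, 'n::finite) laurent set \<Rightarrow> int ^ 'n \<Rightarrow> ('k, 'n) laurent set" where
  "shift N a = (\<lambda>p. monomial (- a) * p) ` N"

definition cech_hull :: "('k::field, 'n::finite) laurent set \<Rightarrow> ('k, 'n) laurent set" where
  "cech_hull I = S_span {monomial b | b. monomial (\<chi> i. max (b $ i) 0) \<in> I}"

text \<open>The ideal \<open>I\<^sup>[\<^sup>a\<^sup>]\<close>.\<close>

definition alexander_dual_cech ::
  "('k::field, 'n::finite) laurent set \<Rightarrow> int ^ 'n \<Rightarrow> ('k, 'n) laurent set" where
  "alexander_dual_cech I a = shift (T_dual (cech_hull I)) (- a) \<inter> polys"


subsection \<open>Well-definedness\<close>

lemma monomial_add: "monomial (a + b) = monomial a * monomial b"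
  by (simp add: monomial_def Poly_Mapping.mult_single)

lemma polys_add: "p \<in> polys \<Longrightarrow> q \<in> polys \<Longrightarrow> p + q \<in> polys"
  using Poly_Mapping.keys_add[of p q] by (auto simp: polys_def)

lemma polys_uminus: "p \<in> polys \<Longrightarrow> - p \<in> polys"
  by (simp add: polys_def)

lemma polys_mult: "p \<in> polys \<Longrightarrow> q \<in> polys \<Longrightarrow> p * q \<in> polys"
  using Poly_Mapping.keys_mult[of p q]
  by (fastforce simp: polys_def less_eq_vec_def)

lemma monomial_in_polys_iff: "monomial b \<in> polys \<longleftrightarrow> 0 \<le> b"
  by (simp add: monomial_def polys_def)

lemma cring_S_ring: "cring S_ring"
proof (rule cringI)
  show "abelian_group (S_ring :: ('k::field, 'n::finite) laurent ring)"
  proof (rule abelian_groupI)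
    fix x :: "('k, 'n) laurent" assume "x \<in> carrier S_ring"
    then show "\<exists>y\<in>carrier S_ring. y \<oplus>\<^bsub>S_ring\<^esub> x = \<zero>\<^bsub>S_ring\<^esub>"
      by (intro bexI[of _ "- x"]) (auto simp: S_ring_def polys_uminus)
  qed (auto simp: S_ring_def polys_add add.assoc add.commute, simp add: polys_def)
  show "Group.comm_monoid (S_ring :: ('k::field, 'n::finite) laurent ring)"
    by (rule Group.comm_monoidI)
      (auto simp: S_ring_def polys_mult mult.assoc mult.commute,
       simp add: polys_def)
qed (auto simp: S_ring_def algebra_simps)

lemma module_T_module: "module S_ring T_module"
proof (rule moduleI[OF cring_S_ring])
  show "abelian_group (T_module :: (('k::field, 'n::finite) laurent, ('k, 'n) laurent) module)"
  proof (rule abelian_groupI)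
    fix x :: "('k, 'n) laurent"
    show "\<exists>y\<in>carrier T_module. y \<oplus>\<^bsub>T_module\<^esub> x = \<zero>\<^bsub>T_module\<^esub>"
      by (intro bexI[of _ "- x"]) (auto simp: T_module_def)
  qed (auto simp: T_module_def algebra_simps)
qed (auto simp: T_module_def S_ring_def algebra_simps)

lemma monomial_T_dual_iff:
  fixes M :: "('k::field, 'n::finite) laurent set"
  assumes "submodule M S_ring T_module"
  shows "monomial (- b) \<in> T_dual M \<longleftrightarrow> monomial b \<notin> M"
proof
  assume "monomial b \<notin> M"
  then show "monomial (- b) \<in> T_dual M"
    unfolding T_dual_def S_span_def by (intro hull_inc) blast
next
  let ?N = "{p :: ('k, 'n) laurent. \<forall>c \<in> Poly_Mapping.keys p. monomial (- c) \<notin> M}"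
  have smult: "s * p \<in> ?N" if "s \<in> polys" "p \<in> ?N" for s p
  proof (clarify)
    fix c assume c: "c \<in> Poly_Mapping.keys (s * p)" "monomial (- c) \<in> M"
    then obtain u v where uv: "u \<in> Poly_Mapping.keys s" "v \<in> Poly_Mapping.keys p" "c = u + v"
      using Poly_Mapping.keys_mult[of s p] by blast
    have "monomial u \<in> carrier S_ring"
      using uv(1) \<open>s \<in> polys\<close> by (simp add: S_ring_def monomial_in_polys_iff) (simp add: polys_def)
    from submodule.smult_closed[OF assms this c(2)]
    have "monomial (- v) \<in> M"
      by (simp add: T_module_def uv(3) monomial_add[symmetric])
    then show False using uv(2) \<open>p \<in> ?N\<close> by blast
  qed
  have "submodule ?N S_ring T_module"
  proof (rule module.submoduleI[OF module_T_module])
    fix p q :: "('k, 'n) laurent" assume "p \<in> ?N" "q \<in> ?N"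
    then show "p \<oplus>\<^bsub>T_module\<^esub> q \<in> ?N"
      using Poly_Mapping.keys_add[of p q] by (auto simp: T_module_def)
  next
    fix p :: "('k, 'n) laurent" assume p: "p \<in> ?N"
    interpret module S_ring T_module by (rule module_T_module)
    have "\<ominus>\<^bsub>T_module\<^esub> p = - p"
      by (rule M.minus_equality) (auto simp: T_module_def)
    then show "\<ominus>\<^bsub>T_module\<^esub> p \<in> ?N" using p by simp
  next
    fix s p :: "('k, 'n) laurent" assume "s \<in> carrier S_ring" "p \<in> ?N"
    then show "s \<odot>\<^bsub>T_module\<^esub> p \<in> ?N"
      using smult[of s p] by (simp add: S_ring_def T_module_def)
  qed (auto simp: T_module_def)
  then have "T_dual M \<subseteq> ?N"
    unfolding T_dual_def S_span_def
    by (intro hull_minimal) (auto simp: monomial_def)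
  moreover assume "monomial (- b) \<in> T_dual M"
  ultimately have "monomial (- b) \<in> ?N" by blast
  then show "monomial b \<notin> M" by (simp add: monomial_def)
qed

lemma monomial_shift_iff: "monomial b \<in> shift N a \<longleftrightarrow> monomial (a + b) \<in> N"
proof
  assume "monomial b \<in> shift N a"
  then obtain p where p: "p \<in> N" "monomial b = monomial (- a) * p" by (auto simp: shift_def)
  have "monomial (a + b) = monomial (a + - a) * p"
    by (simp only: monomial_add p(2) mult.assoc)
  then show "monomial (a + b) \<in> N" using p(1) by (simp add: monomial_def)
next
  assume "monomial (a + b) \<in> N"
  then show "monomial b \<in> shift N a"
    unfolding shift_def by (intro image_eqI[of _ _ "monomial (a + b)"])
      (simp_all add: monomial_add[symmetric])
qed

end

theory Submission
  imports Defs
begin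

text \<open>A monomial submodule of \<open>T\<close> consists of the Laurent polynomials whose exponents lie in a fixed
upward closed set, so the whole statement is about such sets of exponents (\<open>genideal_monomials\<close>,
\<open>S_span_monomials\<close>). Let \<open>c \<ge> 0\<close>. Unwinding shift, \<open>T\<close>-dual and Cech hull, \<open>x\<^sup>c\<close> lies in
\<open>I\<^sup>[\<^sup>a\<^sup>]\<close> iff the monomial with exponent vector \<open>(a - c)\<^sup>+\<close> is not in \<open>I\<close>, that is, iff some
irreducible component \<open>m\<^sup>b\<close> of \<open>I\<close> misses it. Missing it means
\<open>max (a\<^sub>i - c\<^sub>i) 0 < b\<^sub>i\<close> whenever \<open>b\<^sub>i \<ge> 1\<close>, equivalently \<open>a\<^sub>i + 1 - b\<^sub>i \<le> c\<^sub>i\<close>, and this says that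
the generator of \<open>I\<^sup>a\<close> coming from \<open>m\<^sup>b\<close> divides \<open>x\<^sup>c\<close> (\<open>flip_le_iff\<close>).

What this computation presupposes is the theory of irreducible decompositions: that \<open>Irr I\<close> is well
defined, that it intersects to \<open>I\<close>, and that its members are ideals \<open>m\<^sup>b\<close> with \<open>b \<le> a\<close>
(\<open>Irr_decomposition\<close>). Dickson's lemma, in the form that antichains are finite, makes
\<open>lcm_exponent I\<close> a genuine bound on the minimal generators. Below such a bound \<open>I\<close> is the
intersection of the finitely many \<open>m\<^sup>b \<supseteq> I\<close> with \<open>b \<le> a\<close> (\<open>bounded_decomposition\<close>).
Each \<open>m\<^sup>b\<close> is irreducible among all ideals of \<open>S\<close>, not only the monomial ones
(\<open>irreducible_m_pow\<close>): an ideal strictly above it contains a nonzero element all of whose exponents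
sit at the top corner \<open>b\<^sub>i - 1\<close> in the coordinates with \<open>b\<^sub>i \<ge> 1\<close>, and two such elements can be
multiplied. Finally, an irreducible monomial ideal containing a finite intersection of monomial ideals
contains one of them, which gives uniqueness.\<close>


section \<open>Monomial submodules as sets of exponents\<close>

definition upward :: "(int ^ 'n::finite) set \<Rightarrow> (int ^ 'n) set" where
  "upward B = {c. \<exists>b\<in>B. b \<le> c}"

definition supported :: "(int ^ 'n::finite) set \<Rightarrow> ('k::field, 'n) laurent set" where
  "supported U = {p. Poly_Mapping.keys p \<subseteq> U}"

lemma monomial_in_supported_iff [simp]: "monomial c \<in> supported U \<longleftrightarrow> c \<in> U"
  by (simp add: supported_def monomial_def)

lemma supported_eq_iff [simp]:
  "(supported U :: ('k::field, 'n::finite) laurent set) = supported V \<longleftrightarrow> U = V"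
proof
  assume eq: "(supported U :: ('k, 'n) laurent set) = supported V"
  show "U = V"
  proof (rule Set.set_eqI)
    fix c
    show "c \<in> U \<longleftrightarrow> c \<in> V"
      using arg_cong[OF eq, of "\<lambda>M. (monomial c :: ('k, 'n) laurent) \<in> M"] by simp
  qed
qed simp

lemma supported_subset_iff [simp]:
  "(supported U :: ('k::field, 'n::finite) laurent set) \<subseteq> supported V \<longleftrightarrow> U \<subseteq> V"
proof -
  have "(supported U :: ('k, 'n) laurent set) \<inter> supported V = supported (U \<inter> V)"
    by (auto simp: supported_def)
  then show ?thesis by (metis inf.absorb_iff1 supported_eq_iff)
qed

lemma supported_Int: "supported U \<inter> supported V = supported (U \<inter> V)"
  by (auto simp: supported_def)

lemma polys_eq_supported: "polys = supported {c. 0 \<le> c}"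
  by (auto simp: polys_def supported_def)

lemma vec_le_iff_diff_nonneg: "(b::int ^ 'n::finite) \<le> c \<longleftrightarrow> 0 \<le> c - b"
  by (simp add: less_eq_vec_def)

lemma upward_closed: "c \<in> upward B \<Longrightarrow> c \<le> d \<Longrightarrow> d \<in> upward B"
  unfolding upward_def by (auto intro: order_trans)

lemma subset_upward: "B \<subseteq> upward B"
  by (auto simp: upward_def)

lemma upward_nonneg: "B \<subseteq> {c. 0 \<le> c} \<Longrightarrow> upward B \<subseteq> {c. 0 \<le> c}"
  unfolding upward_def by (auto intro: order_trans)

lemma upward_absorb: "(\<And>c d. c \<in> U \<Longrightarrow> c \<le> d \<Longrightarrow> d \<in> U) \<Longrightarrow> upward U = U"
  unfolding upward_def by auto

lemma upward_Un: "upward (A \<union> B) = upward A \<union> upward B"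
  by (auto simp: upward_def)

lemma upward_upward [simp]: "upward (upward B) = upward B"
  by (rule upward_absorb) (rule upward_closed)

lemma supported_add: "p \<in> supported U \<Longrightarrow> q \<in> supported U \<Longrightarrow> p + q \<in> supported U"
  using Poly_Mapping.keys_add[of p q] by (auto simp: supported_def)

lemma supported_mult_polys:
  assumes "s \<in> polys" "p \<in> supported (upward B)"
  shows "s * p \<in> supported (upward B)"
proof -
  have "c \<in> upward B" if c: "c \<in> Poly_Mapping.keys (s * p)" for c
  proof -
    obtain u v where uv: "u \<in> Poly_Mapping.keys s" "v \<in> Poly_Mapping.keys p" "c = u + v"
      using subsetD[OF Poly_Mapping.keys_mult c] by blast
    have "0 \<le> u" using uv(1) assms(1) by (simp add: polys_def)
    have "v \<in> upward B" using uv(2) assms(2) by (auto simp: supported_def)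
    then show ?thesis by (rule upward_closed) (use uv(3) \<open>0 \<le> u\<close> in \<open>simp add: less_eq_vec_def\<close>)
  qed
  then show ?thesis by (auto simp: supported_def)
qed

lemma single_in_polys: "0 \<le> c \<Longrightarrow> Poly_Mapping.single c x \<in> polys"
  by (simp add: polys_def)

text \<open>The common reason why ideals of \<open>S\<close> and submodules of \<open>T\<close> generated by monomials are described by
exponents: a term is a polynomial multiple of a generating monomial below it, and an element is the
sum of its terms.\<close>
lemma supported_upward_least:
  fixes J :: "('k::field, 'n::finite) laurent set"
  assumes zero: "0 \<in> J" and add: "\<And>p q. p \<in> J \<Longrightarrow> q \<in> J \<Longrightarrow> p + q \<in> J"
    and mult: "\<And>s p. s \<in> polys \<Longrightarrow> p \<in> J \<Longrightarrow> s * p \<in> J"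
    and gens: "monomial ` B \<subseteq> J"
  shows "supported (upward B) \<subseteq> J"
proof
  fix p :: "('k, 'n) laurent" assume p: "p \<in> supported (upward B)"
  have single_mem: "Poly_Mapping.single c x \<in> J" if "c \<in> upward B" for c x
  proof -
    obtain b where b: "b \<in> B" "b \<le> c" using \<open>c \<in> upward B\<close> by (auto simp: upward_def)
    have "Poly_Mapping.single c x = Poly_Mapping.single (c - b) x * monomial b"
      by (simp add: monomial_def mult_single)
    also have "\<dots> \<in> J"
      using b gens vec_le_iff_diff_nonneg[of b c] by (intro mult single_in_polys) auto
    finally show ?thesis .
  qed
  have sums: "(\<Sum>c\<in>K. Poly_Mapping.single c (Poly_Mapping.lookup p c)) \<in> J"
    if "finite K" "K \<subseteq> upward B" for K
    using that by (induction K) (auto intro: zero add single_mem)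
  have "p = (\<Sum>c\<in>Poly_Mapping.keys p. Poly_Mapping.single c (Poly_Mapping.lookup p c))"
    by (rule poly_mapping_eqI)
      (auto simp: lookup_sum lookup_single when_def sum.delta in_keys_iff)
  then show "p \<in> J" using sums[of "Poly_Mapping.keys p"] p by (simp add: supported_def)
qed

lemma one_in_polys: "1 \<in> polys"
  by (simp add: polys_def)

lemma ideal_S_ring_iff:
  "ideal J (S_ring :: ('k::field, 'n::finite) laurent ring) \<longleftrightarrow> J \<subseteq> polys \<and> 0 \<in> J \<and>
     (\<forall>p\<in>J. \<forall>q\<in>J. p + q \<in> J) \<and> (\<forall>s\<in>polys. \<forall>p\<in>J. s * p \<in> J)" (is "_ \<longleftrightarrow> ?R")
proof
  assume "ideal J (S_ring :: ('k, 'n) laurent ring)"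
  then interpret ideal J "S_ring :: ('k, 'n) laurent ring" .
  show ?R
    using a_subset additive_subgroup.zero_closed[OF is_additive_subgroup]
      additive_subgroup.a_closed[OF is_additive_subgroup] I_l_closed
    by (auto simp: S_ring_def)
next
  assume J: ?R
  interpret cring "S_ring :: ('k, 'n) laurent ring" by (rule cring_S_ring)
  have neg: "\<ominus>\<^bsub>S_ring\<^esub> p = - p" if "p \<in> polys" for p :: "('k, 'n) laurent"
    by (rule minus_equality) (use that polys_uminus in \<open>auto simp: S_ring_def\<close>)
  have uminus: "- p \<in> J" if "p \<in> J" for p
  proof -
    have "- 1 * p \<in> J" using J that polys_uminus[OF one_in_polys] by blast
    then show ?thesis by simp
  qed
  show "ideal J (S_ring :: ('k, 'n) laurent ring)"
  proof (rule idealI)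
    show "ring (S_ring :: ('k, 'n) laurent ring)" by (rule ring_axioms)
    show "subgroup J (add_monoid (S_ring :: ('k, 'n) laurent ring))"
    proof (rule group.subgroupI[OF a_group])
      fix p assume p: "p \<in> J"
      have "inv\<^bsub>add_monoid S_ring\<^esub> p = - p" using neg[of p] p J by (auto simp: a_inv_def)
      then show "inv\<^bsub>add_monoid S_ring\<^esub> p \<in> J" using uminus[OF p] by simp
    qed (use J in \<open>auto simp: S_ring_def\<close>)
  next
    fix p x :: "('k, 'n) laurent" assume "p \<in> J" "x \<in> carrier S_ring"
    then show "x \<otimes>\<^bsub>S_ring\<^esub> p \<in> J" "p \<otimes>\<^bsub>S_ring\<^esub> x \<in> J"
      using J by (auto simp: S_ring_def mult.commute)
  qed
qed

lemma submodule_T_module_iff: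
  "submodule M S_ring (T_module :: (('k::field, 'n::finite) laurent, ('k, 'n) laurent) module) \<longleftrightarrow>
     0 \<in> M \<and> (\<forall>p\<in>M. \<forall>q\<in>M. p + q \<in> M) \<and> (\<forall>s\<in>polys. \<forall>p\<in>M. s * p \<in> M)" (is "_ \<longleftrightarrow> ?R")
proof
  interpret module S_ring "T_module :: (('k, 'n) laurent, ('k, 'n) laurent) module"
    by (rule module_T_module)
  assume M: "submodule M S_ring (T_module :: (('k, 'n) laurent, ('k, 'n) laurent) module)"
  have mult: "s * p \<in> M" if "s \<in> polys" "p \<in> M" for s p
    using submoduleE(4)[OF M] that by (auto simp: S_ring_def T_module_def)
  obtain p where "p \<in> M" using submoduleE(2)[OF M] by blast
  then have "0 \<in> M" using mult[of 0 p] by (simp add: polys_def)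
  then show ?R using mult submoduleE(5)[OF M] by (auto simp: T_module_def)
next
  assume M: ?R
  interpret module S_ring "T_module :: (('k, 'n) laurent, ('k, 'n) laurent) module"
    by (rule module_T_module)
  have neg: "\<ominus>\<^bsub>T_module\<^esub> p = - p" for p :: "('k, 'n) laurent"
    by (rule M.minus_equality) (auto simp: T_module_def)
  have uminus: "- p \<in> M" if "p \<in> M" for p
  proof -
    have "- 1 * p \<in> M" using M that polys_uminus[OF one_in_polys] by blast
    then show ?thesis by simp
  qed
  show "submodule M S_ring (T_module :: (('k, 'n) laurent, ('k, 'n) laurent) module)"
    by (rule submoduleI) (use M uminus in \<open>auto simp: neg\<close>, auto simp: S_ring_def T_module_def)
qed

lemma ideal_supported:
  "U \<subseteq> {c. 0 \<le> c} \<Longrightarrow> upward U = U \<Longrightarrow> ideal (supported U) S_ring"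
  unfolding ideal_S_ring_iff polys_eq_supported supported_subset_iff
  by (metis polys_eq_supported supported_add supported_mult_polys empty_subsetI keys_zero
      mem_Collect_eq supported_def)

lemma genideal_monomials:
  assumes "B \<subseteq> {c. 0 \<le> c}"
  shows "Idl\<^bsub>S_ring\<^esub> (monomial ` B) = (supported (upward B) :: ('k::field, 'n::finite) laurent set)"
proof
  have "ideal (supported (upward B) :: ('k, 'n) laurent set) S_ring"
    using assms by (intro ideal_supported upward_nonneg) auto
  then show "Idl\<^bsub>S_ring\<^esub> (monomial ` B) \<subseteq> (supported (upward B) :: ('k, 'n) laurent set)"
    unfolding genideal_def using subset_upward[of B] by (intro Inter_lower) auto
  show "(supported (upward B) :: ('k, 'n) laurent set) \<subseteq> Idl\<^bsub>S_ring\<^esub> (monomial ` B)"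
    unfolding genideal_def
    by (intro Inter_greatest supported_upward_least) (auto simp: ideal_S_ring_iff)
qed

lemma S_span_monomials: "S_span (monomial ` B) = supported (upward B)"
  unfolding S_span_def
proof (rule hull_unique)
  show "monomial ` B \<subseteq> supported (upward B)" using subset_upward[of B] by auto
  show "submodule (supported (upward B)) S_ring T_module"
    unfolding submodule_T_module_iff
    using supported_add supported_mult_polys
    by (metis empty_subsetI keys_zero mem_Collect_eq supported_def)
qed (rule supported_upward_least, auto simp: submodule_T_module_iff)

lemma monomial_ideal_iff:
  "monomial_ideal I \<longleftrightarrow> (\<exists>U. U \<subseteq> {c. 0 \<le> c} \<and> upward U = U \<and> I = supported U)"
  unfolding monomial_ideal_def
  by (metis genideal_monomials upward_nonneg upward_upward)


section \<open>Minimal generators\<close>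

text \<open>Dickson's lemma for sequences; the coordinates are handled one at a time, passing
to a subsequence for each.\<close>
lemma coordinatewise_monotone_subsequence:
  fixes f :: "nat \<Rightarrow> int ^ 'n::finite"
  assumes "finite X" "\<And>k. 0 \<le> f k"
  shows "\<exists>r::nat \<Rightarrow> nat. strict_mono r \<and> (\<forall>i\<in>X. \<forall>k l. k \<le> l \<longrightarrow> f (r k) $ i \<le> f (r l) $ i)"
  using assms(1)
proof (induction X)
  case empty
  show ?case by (intro exI[of _ id]) (auto simp: strict_mono_def)
next
  case (insert j X)
  then obtain r :: "nat \<Rightarrow> nat" where r: "strict_mono r"
    and mono: "\<forall>i\<in>X. \<forall>k l. k \<le> l \<longrightarrow> f (r k) $ i \<le> f (r l) $ i" by blast
  define g where "g k = nat (f (r k) $ j)" for k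
  (* Every tail of g attains its minimum; jumping from one such minimum to the next gives the
     monotone subsequence for coordinate j. *)
  have "\<exists>k. \<forall>l. g (m + k) \<le> g (m + l)" for m
    using ex_has_least_nat[of "\<lambda>_. True" 0 "\<lambda>l. g (m + l)"] by auto
  then have "\<forall>m. \<exists>k. m < k \<and> (\<forall>l. Suc m \<le> l \<longrightarrow> g k \<le> g l)"
    by (metis add_Suc le_add1 le_iff_add less_Suc_eq_le less_add_Suc1)
  then obtain h where h: "\<And>m. m < h m" "\<And>m l. Suc m \<le> l \<Longrightarrow> g (h m) \<le> g l"
    by metis
  define s where "s k = (h ^^ Suc k) 0" for k
  have s: "strict_mono s" unfolding strict_mono_Suc_iff s_def using h(1) by simp
  have gs: "g (s k) \<le> g (s l)" if "k \<le> l" for k l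
  proof -
    have "g (s k) \<le> g (s (Suc k))" for k
    proof (cases k)
      case 0
      then show ?thesis using h(1)[of 0] h(1)[of "h 0"] by (auto simp: s_def intro!: h(2))
    next
      case (Suc m)
      have "s m < s (Suc k)" using strict_monoD[OF s, of m "Suc k"] Suc by simp
      then have "g (h (s m)) \<le> g (s (Suc k))" by (intro h(2)) simp
      then show ?thesis using Suc by (simp add: s_def)
    qed
    then show ?thesis using that lift_Suc_mono_le[of "g \<circ> s" k l] by simp
  qed
  show ?case
  proof (intro exI[of _ "r \<circ> s"] conjI)
    show "strict_mono (r \<circ> s)" using r s by (simp add: strict_mono_o)
    have "f (r (s k)) $ j \<le> f (r (s l)) $ j" if "k \<le> l" for k l
      using gs[OF that] assms(2)[of "r (s k)"] assms(2)[of "r (s l)"]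
      by (auto simp: g_def less_eq_vec_def nat_le_eq_zle)
    then show "\<forall>i\<in>insert j X. \<forall>k l. k \<le> l \<longrightarrow> f ((r \<circ> s) k) $ i \<le> f ((r \<circ> s) l) $ i"
      using mono strict_mono_less_eq[OF s] by auto
  qed
qed

lemma finite_antichain:
  fixes A :: "(int ^ 'n::finite) set"
  assumes "A \<subseteq> {c. 0 \<le> c}" "\<And>b c. b \<in> A \<Longrightarrow> c \<in> A \<Longrightarrow> b \<le> c \<Longrightarrow> b = c"
  shows "finite A"
proof (rule ccontr)
  assume "infinite A"
  then obtain f :: "nat \<Rightarrow> int ^ 'n" where f: "inj f" "range f \<subseteq> A"
    using infinite_countable_subset by blast
  obtain r :: "nat \<Rightarrow> nat" where r: "strict_mono r"
    and mono: "\<forall>i\<in>UNIV. \<forall>k l. k \<le> l \<longrightarrow> f (r k) $ i \<le> f (r l) $ i"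
    using coordinatewise_monotone_subsequence[of UNIV f] f(2) assms(1) by auto
  have "f (r 0) = f (r 1)"
    using mono f(2) by (intro assms(2)) (auto simp: less_eq_vec_def)
  then show False using f(1) strict_monoD[OF r, of 0 1] by (auto dest: injD)
qed

definition minimal_elements :: "(int ^ 'n::finite) set \<Rightarrow> (int ^ 'n) set" where
  "minimal_elements U = {b\<in>U. \<forall>c\<in>U. c \<le> b \<longrightarrow> c = b}"

lemma minimal_element_below:
  fixes U :: "(int ^ 'n::finite) set"
  assumes "U \<subseteq> {c. 0 \<le> c}" "c \<in> U"
  shows "\<exists>b\<in>minimal_elements U. b \<le> c"
  using assms(2)
proof (induction "nat (\<Sum>i\<in>UNIV. c $ i)" arbitrary: c rule: less_induct)
  case less
  show ?case
  proof (cases "c \<in> minimal_elements U")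
    case False
    then obtain d where d: "d \<in> U" "d \<le> c" "d \<noteq> c"
      using less.prems by (auto simp: minimal_elements_def)
    have "(\<Sum>i\<in>UNIV. d $ i) < (\<Sum>i\<in>UNIV. c $ i)"
      using d by (intro sum_strict_mono_ex1) (auto simp: less_eq_vec_def vec_eq_iff intro: le_neq_trans)
    moreover have "0 \<le> (\<Sum>i\<in>UNIV. d $ i)"
      using d assms(1) by (intro sum_nonneg) (auto simp: less_eq_vec_def)
    ultimately show ?thesis using less.hyps[of d] d order_trans by fastforce
  qed auto
qed

lemma upward_minimal_elements:
  assumes "U \<subseteq> {c. 0 \<le> c}" "upward U = U"
  shows "upward (minimal_elements U) = U"
proof
  have "minimal_elements U \<subseteq> U" by (auto simp: minimal_elements_def)
  then show "upward (minimal_elements U) \<subseteq> U" using assms(2) by (auto simp: upward_def)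
  show "U \<subseteq> upward (minimal_elements U)"
    using minimal_element_below[OF assms(1)] by (auto simp: upward_def)
qed

text \<open>The minimal exponents generate, and every generating set of monomials contains them; hence the
description defining \<open>min_gens\<close> has exactly one solution.\<close>
lemma min_gens_supported:
  fixes U :: "(int ^ 'n::finite) set"
  assumes U: "U \<subseteq> {c. 0 \<le> c}" "upward U = U"
  shows "min_gens (supported U :: ('k::field, 'n) laurent set) = minimal_elements U"
proof -
  let ?M = "minimal_elements U"
  have M: "?M \<subseteq> {c. 0 \<le> c}" using U by (auto simp: minimal_elements_def)
  have gen_iff: "Idl\<^bsub>S_ring\<^esub> (monomial ` B) = (supported U :: ('k, 'n) laurent set) \<longleftrightarrow> upward B = U"
    if "B \<subseteq> {c. 0 \<le> c}" for B
    using genideal_monomials[OF that] by (metis supported_eq_iff)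
  have least: "?M \<subseteq> B" if B: "upward B = U" for B
  proof
    fix m assume m: "m \<in> ?M"
    then obtain b where "b \<in> B" "b \<le> m" using B by (auto simp: minimal_elements_def upward_def)
    moreover have "b \<in> U" using \<open>b \<in> B\<close> B subset_upward by auto
    ultimately show "m \<in> B" using m by (auto simp: minimal_elements_def)
  qed
  show ?thesis
    unfolding min_gens_def
  proof (rule the_equality)
    show "?M \<subseteq> {b. 0 \<le> b} \<and> Idl\<^bsub>S_ring\<^esub> (monomial ` ?M) = (supported U :: ('k, 'n) laurent set) \<and>
        (\<forall>C. C \<subset> ?M \<longrightarrow> Idl\<^bsub>S_ring\<^esub> (monomial ` C) \<noteq> (supported U :: ('k, 'n) laurent set))"
    proof (intro conjI allI impI M)
      show "Idl\<^bsub>S_ring\<^esub> (monomial ` ?M) = (supported U :: ('k, 'n) laurent set)"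
        using gen_iff[OF M] upward_minimal_elements[OF U] by simp
      fix C assume C: "C \<subset> ?M"
      then show "Idl\<^bsub>S_ring\<^esub> (monomial ` C) \<noteq> (supported U :: ('k, 'n) laurent set)"
        using gen_iff[of C] least[of C] M by auto
    qed
  next
    fix B assume B: "B \<subseteq> {b. 0 \<le> b} \<and> Idl\<^bsub>S_ring\<^esub> (monomial ` B) = (supported U :: ('k, 'n) laurent set) \<and>
        (\<forall>C. C \<subset> B \<longrightarrow> Idl\<^bsub>S_ring\<^esub> (monomial ` C) \<noteq> (supported U :: ('k, 'n) laurent set))"
    then have "?M \<subseteq> B" using gen_iff[of B] least by blast
    then show "B = ?M" using B gen_iff[OF M] upward_minimal_elements[OF U] by blast
  qed
qed

text \<open>The maximum defining \<open>lcm_exponent\<close> bounds the generators only because there are finitely many of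
them.\<close>
lemma lcm_exponent_ge:
  assumes U: "U \<subseteq> {c. 0 \<le> c}" "upward U = U"
    and a: "lcm_exponent (supported U :: ('k::field, 'n::finite) laurent set) \<le> a"
  shows "0 \<le> a" and "\<And>b. b \<in> minimal_elements U \<Longrightarrow> b \<le> a"
proof -
  have fin: "finite (minimal_elements U)"
    using U(1) by (intro finite_antichain) (auto simp: minimal_elements_def)
  have ge: "Max (insert 0 ((\<lambda>b. b $ i) ` minimal_elements U)) \<le> a $ i" for i
    using a unfolding lcm_exponent_def min_gens_supported[OF U] by (simp add: less_eq_vec_def)
  show "0 \<le> a" using ge fin by (auto simp: less_eq_vec_def)
  show "b \<le> a" if "b \<in> minimal_elements U" for b
    using ge fin that by (fastforce simp: less_eq_vec_def)
qed

section \<open>The irreducible monomial ideals\<close>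

text \<open>The exponents of the monomials in \<open>m\<^sup>b\<close>.\<close>
definition power_exponents :: "int ^ 'n::finite \<Rightarrow> (int ^ 'n) set" where
  "power_exponents b = {c. 0 \<le> c \<and> (\<exists>i. 1 \<le> b $ i \<and> b $ i \<le> c $ i)}"

lemma power_exponents_nonneg: "power_exponents b \<subseteq> {c. 0 \<le> c}"
  by (auto simp: power_exponents_def)

lemma upward_power_exponents [simp]: "upward (power_exponents b) = power_exponents b"
proof (rule upward_absorb)
  fix c d :: "int ^ 'a" assume "c \<in> power_exponents b" "c \<le> d"
  then show "d \<in> power_exponents b"
    unfolding power_exponents_def less_eq_vec_def mem_Collect_eq by (meson order_trans)
qed

lemma axis_le_iff:
  fixes c :: "int ^ 'n::finite"
  assumes "0 \<le> x"
  shows "axis i x \<le> c \<longleftrightarrow> 0 \<le> c \<and> x \<le> c $ i"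
proof
  assume l: "axis i x \<le> c"
  have "0 \<le> axis i x $ j" for j using assms by (simp add: axis_def)
  then show "0 \<le> c \<and> x \<le> c $ i"
    using l unfolding less_eq_vec_def by (metis axis_nth order_trans zero_index)
next
  assume "0 \<le> c \<and> x \<le> c $ i"
  then show "axis i x \<le> c" by (auto simp: less_eq_vec_def axis_def)
qed

lemma m_pow_eq_supported:
  "m_pow b = (supported (power_exponents b) :: ('k::field, 'n::finite) laurent set)"
proof -
  let ?B = "{axis i (b $ i) | i. 1 \<le> b $ i}"
  have nonneg: "?B \<subseteq> {c. 0 \<le> c}" by (auto simp: less_eq_vec_def axis_def)
  have "upward ?B = power_exponents b"
  proof (rule Set.set_eqI)
    fix c
    have "c \<in> upward ?B \<longleftrightarrow> (\<exists>i. 1 \<le> b $ i \<and> axis i (b $ i) \<le> c)"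
      by (auto simp: upward_def)
    also have "\<dots> \<longleftrightarrow> (\<exists>i. 1 \<le> b $ i \<and> 0 \<le> c \<and> b $ i \<le> c $ i)"
      by (intro ex_cong1 conj_cong axis_le_iff refl) simp
    finally show "c \<in> upward ?B \<longleftrightarrow> c \<in> power_exponents b"
      by (auto simp: power_exponents_def)
  qed
  moreover have "{monomial (axis i (b $ i)) | i. 1 \<le> b $ i} =
      (monomial ` ?B :: ('k, 'n) laurent set)" by auto
  ultimately show ?thesis by (simp only: m_pow_def genideal_monomials[OF nonneg])
qed

lemma power_exponents_le:
  assumes "0 \<le> b" "0 \<le> b'" "power_exponents b \<subseteq> power_exponents b'" "1 \<le> b $ i"
  shows "1 \<le> b' $ i \<and> b' $ i \<le> b $ i"
proof -
  have "axis i (b $ i) \<in> power_exponents b"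
    using assms(4) by (auto simp: power_exponents_def less_eq_vec_def axis_def)
  then have "axis i (b $ i) \<in> power_exponents b'" using assms(3) by blast
  then obtain j where "1 \<le> b' $ j" "b' $ j \<le> axis i (b $ i) $ j"
    by (auto simp: power_exponents_def)
  then show ?thesis by (cases "j = i") (auto simp: axis_def)
qed

lemma power_exponents_inj:
  assumes "0 \<le> b" "0 \<le> b'" "power_exponents b = power_exponents b'"
  shows "b = b'"
proof (rule vec_eq_iff[THEN iffD2], rule allI)
  fix i
  have "0 \<le> b $ i" "0 \<le> b' $ i" using assms(1,2) by (auto simp: less_eq_vec_def)
  then show "b $ i = b' $ i"
    using power_exponents_le[of b b' i] power_exponents_le[of b' b i] assms by force
qed

lemma monomial_ideal_m_pow: "monomial_ideal (m_pow b)"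
  unfolding monomial_ideal_iff
  by (intro exI[of _ "power_exponents b"] conjI power_exponents_nonneg upward_power_exponents
      m_pow_eq_supported)

lemma ideal_m_pow: "ideal (m_pow b) S_ring"
  unfolding m_pow_eq_supported by (intro ideal_supported power_exponents_nonneg) simp

lemma zero_notin_power_exponents: "0 \<notin> power_exponents b"
  by (auto simp: power_exponents_def)

lemma m_pow_proper: "m_pow b \<noteq> polys"
  unfolding m_pow_eq_supported polys_eq_supported supported_eq_iff
  using zero_notin_power_exponents by blast

text \<open>Stands in for a monomial order on \<open>int ^ 'n\<close>: some sum of an element of \<open>A\<close> and an element of \<open>B\<close>
arises in one way only. Restricting both sets to their elements with maximal \<open>i\<close>th coordinate, for
one \<open>i\<close> after the other, never loses a representation of a surviving sum, and in the end
one element is left on each side.\<close>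
lemma unique_extremal_sum:
  fixes A B :: "(int ^ 'n::finite) set"
  assumes "finite A" "A \<noteq> {}" "finite B" "B \<noteq> {}"
  obtains a b where "a \<in> A" "b \<in> B"
    "\<And>a' b'. a' \<in> A \<Longrightarrow> b' \<in> B \<Longrightarrow> a' + b' = a + b \<Longrightarrow> a' = a \<and> b' = b"
proof -
  have "\<exists>A' B'. A' \<subseteq> A \<and> A' \<noteq> {} \<and> B' \<subseteq> B \<and> B' \<noteq> {} \<and>
      (\<forall>i\<in>X. \<forall>a\<in>A'. \<forall>a'\<in>A'. a $ i = a' $ i) \<and> (\<forall>i\<in>X. \<forall>b\<in>B'. \<forall>b'\<in>B'. b $ i = b' $ i) \<and>
      (\<forall>a\<in>A'. \<forall>b\<in>B'. \<forall>a'\<in>A. \<forall>b'\<in>B. a' + b' = a + b \<longrightarrow> a' \<in> A' \<and> b' \<in> B')"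
    if "finite X" for X :: "'n set"
    using that
  proof (induction X)
    case empty
    show ?case by (rule exI[of _ A], rule exI[of _ B]) (use assms in auto)
  next
    case (insert i X)
    then obtain A' B' where sub: "A' \<subseteq> A" "A' \<noteq> {}" "B' \<subseteq> B" "B' \<noteq> {}"
      and const: "\<forall>i\<in>X. \<forall>a\<in>A'. \<forall>a'\<in>A'. a $ i = a' $ i" "\<forall>i\<in>X. \<forall>b\<in>B'. \<forall>b'\<in>B'. b $ i = b' $ i"
      and closed: "\<forall>a\<in>A'. \<forall>b\<in>B'. \<forall>a'\<in>A. \<forall>b'\<in>B. a' + b' = a + b \<longrightarrow> a' \<in> A' \<and> b' \<in> B'"
      by (elim exE conjE) (rule that)
    define top where "top C = {c\<in>C. \<forall>d\<in>C. d $ i \<le> c $ i}" for C :: "(int ^ 'n) set"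
    have top_ne: "top C \<noteq> {}" if "finite C" "C \<noteq> {}" for C
    proof -
      have "Max ((\<lambda>d. d $ i) ` C) \<in> (\<lambda>d. d $ i) ` C" using that by (intro Max_in) auto
      then obtain c where "c \<in> C" "c $ i = Max ((\<lambda>d. d $ i) ` C)" by (metis imageE)
      then have "c \<in> top C" using that by (auto simp: top_def)
      then show ?thesis by blast
    qed
    have fin: "finite A'" "finite B'" using sub assms finite_subset by blast+
    have closed_top: "a' \<in> top A' \<and> b' \<in> top B'"
      if ab: "a \<in> top A'" "b \<in> top B'" "a' \<in> A" "b' \<in> B" and eq: "a' + b' = a + b" for a b a' b'
    proof -
      have mem: "a' \<in> A'" "b' \<in> B'" using closed ab eq unfolding top_def by blast+
      have "a' $ i + b' $ i = a $ i + b $ i" using arg_cong[OF eq, of "\<lambda>c. c $ i"] by simp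
      moreover have "a' $ i \<le> a $ i" "b' $ i \<le> b $ i" using mem ab by (auto simp: top_def)
      ultimately have "a' $ i = a $ i" "b' $ i = b $ i" by linarith+
      then show ?thesis using mem ab by (auto simp: top_def)
    qed
    have top_sub: "top C \<subseteq> C" for C by (auto simp: top_def)
    show ?case
    proof (rule exI[of _ "top A'"], rule exI[of _ "top B'"], intro conjI)
      show "\<forall>j\<in>insert i X. \<forall>a\<in>top A'. \<forall>a'\<in>top A'. a $ j = a' $ j"
        "\<forall>j\<in>insert i X. \<forall>b\<in>top B'. \<forall>b'\<in>top B'. b $ j = b' $ j"
        using const by (auto simp: top_def intro: order_antisym)
      show "top A' \<noteq> {}" "top B' \<noteq> {}" using top_ne fin sub by blast+
      show "top A' \<subseteq> A" "top B' \<subseteq> B" using top_sub sub by blast+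
    qed (use closed_top in blast)
  qed
  from this[OF finite_class.finite_UNIV]
  obtain A' B' where sub: "A' \<subseteq> A" "A' \<noteq> {}" "B' \<subseteq> B" "B' \<noteq> {}"
    and coords: "\<forall>i\<in>UNIV. \<forall>a\<in>A'. \<forall>a'\<in>A'. a $ i = a' $ i"
      "\<forall>i\<in>UNIV. \<forall>b\<in>B'. \<forall>b'\<in>B'. b $ i = b' $ i"
    and closed: "\<forall>a\<in>A'. \<forall>b\<in>B'. \<forall>a'\<in>A. \<forall>b'\<in>B. a' + b' = a + b \<longrightarrow> a' \<in> A' \<and> b' \<in> B'"
    by (elim exE conjE) (rule that)
  have const: "\<forall>a\<in>A'. \<forall>a'\<in>A'. a = a'" "\<forall>b\<in>B'. \<forall>b'\<in>B'. b = b'"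
    unfolding vec_eq_iff using coords by blast+
  obtain a b where "a \<in> A'" "b \<in> B'" using sub by blast
  show thesis
  proof (rule that[of a b])
    fix a' b' assume "a' \<in> A" "b' \<in> B" "a' + b' = a + b"
    then have "a' \<in> A'" "b' \<in> B'" using closed \<open>a \<in> A'\<close> \<open>b \<in> B'\<close> by blast+
    then show "a' = a \<and> b' = b" using const \<open>a \<in> A'\<close> \<open>b \<in> B'\<close> by blast
  qed (use sub \<open>a \<in> A'\<close> \<open>b \<in> B'\<close> in auto)
qed

text \<open>The coefficient at a sum that arises in one way only is a single product of nonzero coefficients.\<close>
lemma laurent_mult_nonzero:
  fixes p q :: "('k::field, 'n::finite) laurent"
  assumes "p \<noteq> 0" "q \<noteq> 0"
  shows "p * q \<noteq> 0"
proof -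
  obtain a b where a: "a \<in> Poly_Mapping.keys p" and b: "b \<in> Poly_Mapping.keys q"
    and uniq: "\<And>a' b'. a' \<in> Poly_Mapping.keys p \<Longrightarrow> b' \<in> Poly_Mapping.keys q \<Longrightarrow>
      a' + b' = a + b \<Longrightarrow> a' = a \<and> b' = b"
    using unique_extremal_sum[of "Poly_Mapping.keys p" "Poly_Mapping.keys q"] assms
    by (metis finite_keys keys_eq_empty)
  have inner: "Sum_any (\<lambda>d. Poly_Mapping.lookup q d when a + b = c + d) =
      Poly_Mapping.lookup q (a + b - c)" for c
  proof -
    have "(\<lambda>d. Poly_Mapping.lookup q d when a + b = c + d) =
        (\<lambda>d. Poly_Mapping.lookup q d when d = a + b - c)"
      by (rule ext) (auto simp: when_def algebra_simps)
    then show ?thesis by (simp only: Sum_any_when_equal)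
  qed
  have "Poly_Mapping.lookup p c * Poly_Mapping.lookup q (a + b - c) =
      (Poly_Mapping.lookup p c * Poly_Mapping.lookup q b when c = a)" for c
    using uniq[of c "a + b - c"] by (auto simp: when_def in_keys_iff)
  then have "Poly_Mapping.lookup (p * q) (a + b) = Poly_Mapping.lookup p a * Poly_Mapping.lookup q b"
    by (simp add: lookup_mult inner)
  then show ?thesis using a b by (auto simp: in_keys_iff)
qed

lemma monomial_nonzero: "monomial e \<noteq> 0"
  using lookup_single_eq[of e "1 :: 'b::field"] unfolding monomial_def by force

lemma split_by_exponents:
  fixes p :: "('k::field, 'n::finite) laurent"
  obtains q r where "p = q + r" "q \<in> supported U"
    "Poly_Mapping.keys r = Poly_Mapping.keys p - U"
proof -
  define part where "part V = (\<Sum>c\<in>Poly_Mapping.keys p \<inter> V. Poly_Mapping.single c (Poly_Mapping.lookup p c))"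
    for V
  have look: "Poly_Mapping.lookup (part V) c = (if c \<in> V then Poly_Mapping.lookup p c else 0)" for V c
    by (auto simp: part_def lookup_sum lookup_single when_def sum.delta in_keys_iff)
  show thesis
  proof (rule that)
    show "p = part U + part (- U)" by (rule poly_mapping_eqI) (simp add: lookup_add look)
    show "part U \<in> supported U" by (auto simp: supported_def in_keys_iff look split: if_splits)
    show "Poly_Mapping.keys (part (- U)) = Poly_Mapping.keys p - U"
      by (auto simp: in_keys_iff look split: if_splits)
  qed
qed

lemma keys_monomial_mult:
  "Poly_Mapping.keys (monomial e * p) = (\<lambda>d. e + d) ` Poly_Mapping.keys p"
proof -
  have sub: "Poly_Mapping.keys (monomial e * p) \<subseteq> (\<lambda>d. e + d) ` Poly_Mapping.keys p" for e p
    using Poly_Mapping.keys_mult[of "monomial e" p] by (auto simp: monomial_def)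
  have "p = monomial (- e) * (monomial e * p)"
    by (simp add: mult.assoc[symmetric] monomial_add[symmetric]) (simp add: monomial_def)
  then have "Poly_Mapping.keys p \<subseteq> (\<lambda>d. - e + d) ` Poly_Mapping.keys (monomial e * p)"
    using sub by metis
  then have "(\<lambda>d. e + d) ` Poly_Mapping.keys p \<subseteq> Poly_Mapping.keys (monomial e * p)"
    by auto
  then show ?thesis using sub by blast
qed

text \<open>Modulo \<open>m\<^sup>b\<close>, every nonzero ideal meets the part of degree \<open>b\<^sub>i - 1\<close> in the coordinates with
\<open>b\<^sub>i \<ge> 1\<close>. Take an exponent \<open>c\<close> of an element of \<open>K\<close> that lies outside \<open>m\<^sup>b\<close> and has the least
total degree in these coordinates, and multiply by the monomial that moves \<open>c\<close> to this corner. Any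
other exponent outside \<open>m\<^sup>b\<close> either moves to the corner too or is pushed into \<open>m\<^sup>b\<close>.\<close>
lemma socle_element:
  fixes K :: "('k::field, 'n::finite) laurent set"
  assumes K: "ideal K S_ring" and sub: "m_pow b \<subset> K"
  shows "\<exists>f\<in>K. f \<noteq> 0 \<and> (\<forall>c\<in>Poly_Mapping.keys f. \<forall>i. 1 \<le> b $ i \<longrightarrow> c $ i = b $ i - 1)"
proof -
  let ?W = "power_exponents b"
  have Kp: "K \<subseteq> polys" and Kadd: "\<And>p q. p \<in> K \<Longrightarrow> q \<in> K \<Longrightarrow> p + q \<in> K"
    and Kmult: "\<And>s p. s \<in> polys \<Longrightarrow> p \<in> K \<Longrightarrow> s * p \<in> K"
    using K by (auto simp: ideal_S_ring_iff)
  define deg where "deg c = (\<Sum>i | 1 \<le> b $ i. c $ i)" for c :: "int ^ 'n"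
  obtain g where g: "g \<in> K" "g \<notin> supported ?W" using sub by (auto simp: m_pow_eq_supported)
  then have "Poly_Mapping.keys g - ?W \<noteq> {}" by (auto simp: supported_def)
  then obtain c where c: "c \<in> Poly_Mapping.keys g" "c \<notin> ?W"
    and least: "\<And>d. d \<in> Poly_Mapping.keys g \<Longrightarrow> d \<notin> ?W \<Longrightarrow> deg c \<le> deg d"
    using ex_min_if_finite[of "deg ` (Poly_Mapping.keys g - ?W)"] by (fastforce simp: not_less)
  have g_nonneg: "0 \<le> d" if "d \<in> Poly_Mapping.keys g" for d
    using that g(1) Kp by (auto simp: polys_def)
  have outside: "d $ i < b $ i" if "d \<notin> ?W" "0 \<le> d" "1 \<le> b $ i" for d i
    using that by (force simp: power_exponents_def)
  define e where "e = (\<chi> i. if 1 \<le> b $ i then b $ i - 1 - c $ i else 0)"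
  have e: "0 \<le> e"
    using outside[OF c(2) g_nonneg[OF c(1)]] by (fastforce simp: e_def less_eq_vec_def)
  obtain q f where split: "monomial e * g = q + f" "q \<in> supported ?W"
    "Poly_Mapping.keys f = Poly_Mapping.keys (monomial e * g) - ?W"
    using split_by_exponents by blast
  have "f \<in> K"
  proof -
    have "monomial e * g \<in> K" using e g(1) Kmult monomial_in_polys_iff by blast
    moreover have "- q \<in> K"
      using split(2) sub Kmult[OF polys_uminus[OF one_in_polys], of q] by (auto simp: m_pow_eq_supported)
    ultimately have "monomial e * g + - q \<in> K" by (rule Kadd)
    then show ?thesis by (simp add: split(1))
  qed
  moreover have "f \<noteq> 0"
  proof -
    have "e + c \<notin> ?W" by (auto simp: power_exponents_def e_def)
    then have "e + c \<in> Poly_Mapping.keys f" using c(1) by (simp add: split(3) keys_monomial_mult)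
    then show ?thesis by auto
  qed
  moreover have "h $ i = b $ i - 1" if h: "h \<in> Poly_Mapping.keys f" "1 \<le> b $ i" for h i
  proof -
    obtain d where d: "h = e + d" "d \<in> Poly_Mapping.keys g" "e + d \<notin> ?W"
      using h(1) by (auto simp: split(3) keys_monomial_mult)
    have ed: "0 \<le> e + d" using e g_nonneg[OF d(2)] by (auto simp: less_eq_vec_def)
    have le: "d $ j \<le> c $ j" if "1 \<le> b $ j" for j
      using outside[OF d(3) ed that] that by (simp add: e_def)
    have "d \<notin> ?W"
    proof
      assume "d \<in> ?W"
      then have "e + d \<in> ?W"
        using upward_closed[of d ?W "e + d"] e by (simp add: less_eq_vec_def)
      then show False using d(3) by simp
    qed
    then have "deg c \<le> deg d" using least d(2) by blast
    have "d $ i = c $ i"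
    proof (rule ccontr)
      assume "d $ i \<noteq> c $ i"
      then have "deg d < deg c"
        unfolding deg_def using le h(2) le_neq_trans[OF le[OF h(2)]]
        by (intro sum_strict_mono_ex1) auto
      then show False using \<open>deg c \<le> deg d\<close> by simp
    qed
    then show ?thesis using h(2) by (simp add: d(1) e_def)
  qed
  ultimately show ?thesis by blast
qed

text \<open>If \<open>m\<^sup>b = J1 \<inter> J2\<close> with both ideals strictly larger, pick corner elements \<open>f \<in> J1\<close> and \<open>g \<in> J2\<close>. Both
are divisible by the monomial with exponents \<open>b\<^sub>i - 1\<close> (where \<open>b\<^sub>i \<ge> 1\<close>), so dividing \<open>f g\<close> by it once
gives an element of \<open>J1 \<inter> J2\<close>. It is nonzero and its exponents are again at the corner, hence outside
\<open>m\<^sup>b\<close>.\<close>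
lemma irreducible_m_pow: "irreducible_ideal S_ring (m_pow b :: ('k::field, 'n::finite) laurent set)"
  unfolding irreducible_ideal_def
proof (intro conjI allI impI ideal_m_pow)
  show "m_pow b \<noteq> carrier (S_ring :: ('k, 'n) laurent ring)"
    using m_pow_proper by (simp add: S_ring_def)
next
  fix J1 J2 :: "('k, 'n) laurent set"
  assume "ideal J1 S_ring \<and> ideal J2 S_ring \<and> m_pow b = J1 \<inter> J2"
  then have J: "ideal J1 S_ring" "ideal J2 S_ring" and eq: "m_pow b = J1 \<inter> J2" by auto
  show "m_pow b = J1 \<or> m_pow b = J2"
  proof (rule ccontr)
    assume "\<not> (m_pow b = J1 \<or> m_pow b = J2)"
    then have strict: "m_pow b \<subset> J1" "m_pow b \<subset> J2" using eq by blast+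
    obtain f where f: "f \<in> J1" "f \<noteq> 0"
      "\<forall>c\<in>Poly_Mapping.keys f. \<forall>i. 1 \<le> b $ i \<longrightarrow> c $ i = b $ i - 1"
      using socle_element[OF J(1) strict(1)] by blast
    obtain g where g: "g \<in> J2" "g \<noteq> 0"
      "\<forall>c\<in>Poly_Mapping.keys g. \<forall>i. 1 \<le> b $ i \<longrightarrow> c $ i = b $ i - 1"
      using socle_element[OF J(2) strict(2)] by blast
    have fp: "f \<in> polys" and gp: "g \<in> polys" using f g J by (auto simp: ideal_S_ring_iff)
    define e where "e = (\<chi> i. if 1 \<le> b $ i then 1 - b $ i else 0)"
    have div: "monomial e * h \<in> polys" if "h \<in> polys"
      "\<forall>c\<in>Poly_Mapping.keys h. \<forall>i. 1 \<le> b $ i \<longrightarrow> c $ i = b $ i - 1"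
      for h :: "('k, 'n) laurent"
      using that by (auto simp: polys_def keys_monomial_mult less_eq_vec_def e_def)
    define p where "p = (monomial e * f) * g"
    have "p \<in> J2" using div[OF fp f(3)] g(1) J(2) by (auto simp: p_def ideal_S_ring_iff)
    moreover have "p = (monomial e * g) * f" by (simp add: p_def mult_ac)
    then have "p \<in> J1" using div[OF gp g(3)] f(1) J(1) by (auto simp: ideal_S_ring_iff)
    ultimately have "Poly_Mapping.keys p \<subseteq> power_exponents b"
      using eq by (auto simp: m_pow_eq_supported supported_def)
    moreover have "c \<notin> power_exponents b" if c: "c \<in> Poly_Mapping.keys p" for c
    proof -
      have "p = monomial e * (f * g)" by (simp add: p_def mult_ac)
      then obtain d where d: "d \<in> Poly_Mapping.keys (f * g)" "c = e + d"
        using c by (auto simp: keys_monomial_mult)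
      obtain u v where uv: "u \<in> Poly_Mapping.keys f" "v \<in> Poly_Mapping.keys g" "d = u + v"
        using subsetD[OF Poly_Mapping.keys_mult d(1)] by blast
      have "c $ i = b $ i - 1" if "1 \<le> b $ i" for i
        using that f(3) g(3) uv(1,2) by (simp add: d(2) uv(3) e_def)
      then show ?thesis by (auto simp: power_exponents_def)
    qed
    ultimately have "p = 0" by (metis keys_eq_empty subset_empty subset_iff)
    moreover have "p \<noteq> 0"
      unfolding p_def by (intro laurent_mult_nonzero f(2) g(2) monomial_nonzero)
    ultimately show False by simp
  qed
qed


section \<open>Irreducible decompositions\<close>

text \<open>The bound on the generators is what allows \<open>b \<le> a\<close>. A monomial \<open>x\<^sup>c\<close> outside the ideal is excluded by
the \<open>m\<^sup>b\<close> with \<open>b\<^sub>i = c\<^sub>i + 1\<close> where \<open>c\<^sub>i < a\<^sub>i\<close> and no condition in the other coordinates: a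
generator does not divide \<open>x\<^sup>c\<close>, so it exceeds \<open>c\<close> in some coordinate, and being at most \<open>a\<close> it does
so where \<open>c\<^sub>i < a\<^sub>i\<close>.\<close>
lemma bounded_decomposition:
  fixes a :: "int ^ 'n::finite"
  assumes U: "U \<subseteq> {c. 0 \<le> c}" "upward U = U" and "0 \<le> a"
    and le: "\<And>m. m \<in> minimal_elements U \<Longrightarrow> m \<le> a"
  shows "polys \<inter> \<Inter>{m_pow b | b. 0 \<le> b \<and> b \<le> a \<and> U \<subseteq> power_exponents b} =
    (supported U :: ('k::field, 'n) laurent set)" (is "polys \<inter> \<Inter>?D = _")
proof
  show "(supported U :: ('k, 'n) laurent set) \<subseteq> polys \<inter> \<Inter>?D"
    using U(1) by (auto simp: polys_eq_supported m_pow_eq_supported supported_def)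
  show "polys \<inter> \<Inter>?D \<subseteq> (supported U :: ('k, 'n) laurent set)"
  proof
    fix p :: "('k, 'n) laurent" assume p: "p \<in> polys \<inter> \<Inter>?D"
    have "c \<in> U" if c: "c \<in> Poly_Mapping.keys p" for c
    proof (rule ccontr)
      assume "c \<notin> U"
      have "0 \<le> c" using c p by (auto simp: polys_def)
      define b where "b = (\<chi> i. if c $ i < a $ i then c $ i + 1 else 0)"
      have "U \<subseteq> power_exponents b"
      proof
        fix d assume d: "d \<in> U"
        obtain m where m: "m \<in> minimal_elements U" "m \<le> d"
          using minimal_element_below[OF U(1) d] by blast
        have "\<not> m \<le> c"
          using \<open>c \<notin> U\<close> m(1) upward_minimal_elements[OF U] by (auto simp: upward_def)
        then obtain i where "c $ i < m $ i" by (auto simp: less_eq_vec_def not_le)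
        moreover have "m $ i \<le> a $ i" "m $ i \<le> d $ i" "0 \<le> c $ i"
          using le[OF m(1)] m(2) \<open>0 \<le> c\<close> by (auto simp: less_eq_vec_def)
        ultimately show "d \<in> power_exponents b"
          using d U(1) by (auto simp: power_exponents_def b_def intro!: exI[of _ i])
      qed
      moreover have "0 \<le> b" "b \<le> a"
        using \<open>0 \<le> c\<close> \<open>0 \<le> a\<close> by (auto simp: b_def less_eq_vec_def)
      ultimately have "m_pow b \<in> ?D" by blast
      then have "p \<in> m_pow b" using p by blast
      then have "c \<in> power_exponents b" using c by (auto simp: m_pow_eq_supported supported_def)
      then show False by (auto simp: power_exponents_def b_def split: if_splits)
    qed
    then show "p \<in> supported U" by (auto simp: supported_def)
  qed
qed

lemma finite_box: "finite {b :: int ^ 'n::finite. 0 \<le> b \<and> b \<le> a}"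
proof (rule finite_subset)
  show "{b. 0 \<le> b \<and> b \<le> a} \<subseteq> (\<lambda>f. \<chi> i. f i) ` (PiE UNIV (\<lambda>i. {0..a $ i}))"
  proof
    fix b :: "int ^ 'n" assume "b \<in> {b. 0 \<le> b \<and> b \<le> a}"
    then show "b \<in> (\<lambda>f. \<chi> i. f i) ` (PiE UNIV (\<lambda>i. {0..a $ i}))"
      by (intro image_eqI[of _ _ "\<lambda>i. b $ i"]) (auto simp: less_eq_vec_def vec_eq_iff)
  qed
qed (intro finite_imageI finite_PiE, auto)

lemma irreducible_member_of_intersection:
  assumes "irreducible_ideal R J" "cring R" "finite D" "\<And>K. K \<in> D \<Longrightarrow> ideal K R"
    and "J = carrier R \<inter> \<Inter>D"
  shows "J \<in> D"
  using assms(3-5)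
proof (induction D)
  case empty
  then show ?case using assms(1) by (simp add: irreducible_ideal_def)
next
  case (insert K D)
  interpret cring R by (rule assms(2))
  have "ideal (carrier R \<inter> \<Inter>D) R"
  proof -
    have "carrier R \<inter> \<Inter>D = \<Inter>(insert (carrier R) D)" by auto
    then show ?thesis using i_Intersect[of "insert (carrier R) D"] oneideal insert.prems(1) by auto
  qed
  moreover have "ideal K R" "J = (carrier R \<inter> \<Inter>D) \<inter> K" using insert.prems by auto
  ultimately have "J = carrier R \<inter> \<Inter>D \<or> J = K"
    using assms(1) unfolding irreducible_ideal_def by blast
  then show ?case using insert.IH insert.prems(1) by auto
qed

text \<open>For monomial ideals sum distributes over intersection: if \<open>J\<close> contains the intersection of the \<open>K\<close> in
\<open>D\<close>, then \<open>J\<close> is the intersection of the sums \<open>J + K\<close>, so irreducibility gives \<open>J = J + K\<close> for some \<open>K\<close>.\<close>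
lemma irreducible_monomial_contains_component:
  fixes J :: "('k::field, 'n::finite) laurent set"
  assumes J: "monomial_ideal J" "irreducible_ideal S_ring J"
    and D: "finite D" "\<And>K. K \<in> D \<Longrightarrow> monomial_ideal K" and sub: "polys \<inter> \<Inter>D \<subseteq> J"
  shows "\<exists>K\<in>D. K \<subseteq> J"
proof -
  obtain W where W: "W \<subseteq> {c. 0 \<le> c}" "upward W = W" "J = supported W"
    using J(1) by (auto simp: monomial_ideal_iff)
  have "\<exists>V. V \<subseteq> {c. 0 \<le> c} \<and> upward V = V \<and> supported V = K" if "K \<in> D" for K
    using D(2)[OF that] unfolding monomial_ideal_iff by auto
  then have "\<forall>K\<in>D. \<exists>V. V \<subseteq> {c. 0 \<le> c} \<and> upward V = V \<and> supported V = K" by (rule ballI)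
  then obtain E where
    "\<forall>K\<in>D. E K \<subseteq> {c. 0 \<le> c} \<and> upward (E K) = E K \<and> supported (E K) = K"
    by (rule bchoice[THEN exE])
  then have E: "\<And>K. K \<in> D \<Longrightarrow> E K \<subseteq> {c. 0 \<le> c}" "\<And>K. K \<in> D \<Longrightarrow> upward (E K) = E K"
    "\<And>K. K \<in> D \<Longrightarrow> supported (E K) = K"
    by simp_all
  (* The ideals J + K: on exponents, sums of monomial ideals are unions. *)
  define D' where "D' = (\<lambda>K. supported (W \<union> E K) :: ('k, 'n) laurent set) ` D"
  have "ideal L S_ring" if "L \<in> D'" for L
    using that W E unfolding D'_def by (auto intro!: ideal_supported simp: upward_Un)
  moreover have "J = carrier S_ring \<inter> \<Inter>D'"
  proof
    show "J \<subseteq> carrier S_ring \<inter> \<Inter>D'"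
      using W(1) by (auto simp: W(3) S_ring_def polys_eq_supported D'_def supported_def)
    show "carrier S_ring \<inter> \<Inter>D' \<subseteq> J"
    proof
      fix p assume p: "p \<in> carrier S_ring \<inter> \<Inter>D'"
      have "c \<in> W" if c: "c \<in> Poly_Mapping.keys p" for c
      proof (rule ccontr)
        assume "c \<notin> W"
        then have "monomial c \<in> K" if K: "K \<in> D" for K
        proof -
          have "c \<in> W \<union> E K" using p c K by (auto simp: D'_def supported_def)
          then show ?thesis using E(3)[OF K] \<open>c \<notin> W\<close> by (metis UnE monomial_in_supported_iff)
        qed
        moreover have "monomial c \<in> polys"
          using p c by (simp only: monomial_in_polys_iff) (simp add: S_ring_def polys_def)
        ultimately have "(monomial c :: ('k, 'n) laurent) \<in> J" using sub by blast
        then show False using \<open>c \<notin> W\<close> by (simp add: W(3))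
      qed
      then show "p \<in> J" by (auto simp: W(3) supported_def)
    qed
  qed
  ultimately have "J \<in> D'"
    using irreducible_member_of_intersection[OF J(2) cring_S_ring] D(1) by (simp add: D'_def)
  then obtain K where K: "K \<in> D" "W = W \<union> E K" by (auto simp: D'_def W(3))
  have "supported (E K) \<subseteq> J" unfolding W(3) supported_subset_iff using K(2) by blast
  then show ?thesis using K(1) E(3) by auto
qed

text \<open>Each member \<open>J\<close> of \<open>D\<close> contains some \<open>K \<in> D'\<close>, which contains some \<open>L \<in> D\<close>; if \<open>L \<noteq> J\<close> then \<open>J\<close>
could be dropped from \<open>D\<close>, so \<open>L = K = J\<close>.\<close>
lemma irredundant_decomposition_subset:
  fixes I :: "('k::field, 'n::finite) laurent set"
  assumes D: "irredundant_irreducible_decomposition I D"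
    and D': "irredundant_irreducible_decomposition I D'"
  shows "D \<subseteq> D'"
proof
  fix J assume J: "J \<in> D"
  have contains: "\<exists>K\<in>F. K \<subseteq> L" if "irredundant_irreducible_decomposition I E"
    "irredundant_irreducible_decomposition I F" "L \<in> E" for E F L
    using that by (intro irreducible_monomial_contains_component)
      (auto simp: irredundant_irreducible_decomposition_def)
  obtain K where K: "K \<in> D'" "K \<subseteq> J" using contains[OF D D' J] by blast
  obtain L where L: "L \<in> D" "L \<subseteq> K" using contains[OF D' D K(1)] by blast
  have "L = J"
  proof (rule ccontr)
    assume "L \<noteq> J"
    then have "polys \<inter> \<Inter>(D - {J}) = polys \<inter> \<Inter>D" using L K(2) J by blast
    then show False using D J by (auto simp: irredundant_irreducible_decomposition_def)
  qed
  then show "J \<in> D'" using K L by simp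
qed

lemma exists_irredundant_subfamily:
  assumes "finite D" "polys \<inter> \<Inter>D = I"
  shows "\<exists>E\<subseteq>D. polys \<inter> \<Inter>E = I \<and> (\<forall>J\<in>E. polys \<inter> \<Inter>(E - {J}) \<noteq> I)"
  using assms
proof (induction D rule: finite_psubset_induct)
  case (psubset D)
  show ?case
  proof (cases "\<forall>J\<in>D. polys \<inter> \<Inter>(D - {J}) \<noteq> I")
    case True
    then show ?thesis using psubset.prems by blast
  next
    case False
    then obtain J where J: "J \<in> D" "polys \<inter> \<Inter>(D - {J}) = I" by blast
    then have "D - {J} \<subset> D" by blast
    from psubset.IH[OF this J(2)] obtain E where "E \<subseteq> D - {J}"
      "polys \<inter> \<Inter>E = I \<and> (\<forall>J\<in>E. polys \<inter> \<Inter>(E - {J}) \<noteq> I)"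
      by (elim exE conjE) (rule that, assumption, rule conjI)
    then show ?thesis by (intro exI[of _ E] conjI) (blast, simp_all)
  qed
qed

text \<open>An irredundant subfamily of the decomposition bounded by \<open>a\<close> is an irredundant irreducible
decomposition; by uniqueness it is \<open>Irr\<close>, which therefore inherits the bound.\<close>
lemma Irr_decomposition:
  fixes a :: "int ^ 'n::finite"
  assumes U: "U \<subseteq> {c. 0 \<le> c}" "upward U = U"
    and a: "lcm_exponent (supported U :: ('k::field, 'n) laurent set) \<le> a"
  shows "Irr (supported U :: ('k, 'n) laurent set) \<subseteq> {m_pow b | b. 0 \<le> b \<and> b \<le> a}"
    and "polys \<inter> \<Inter>(Irr (supported U)) = (supported U :: ('k, 'n) laurent set)"
proof -
  let ?D = "{m_pow b | b. 0 \<le> b \<and> b \<le> a \<and> U \<subseteq> power_exponents b} :: ('k, 'n) laurent set set"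
  have "?D \<subseteq> m_pow ` {b. 0 \<le> b \<and> b \<le> a}" by auto
  then have "finite ?D" by (rule finite_subset) (intro finite_imageI finite_box)
  have "polys \<inter> \<Inter>?D = supported U"
    by (rule bounded_decomposition[OF U lcm_exponent_ge[OF U a]])
  from exists_irredundant_subfamily[OF \<open>finite ?D\<close> this] obtain E where E: "E \<subseteq> ?D" "polys \<inter> \<Inter>E = supported U"
    "\<forall>J\<in>E. polys \<inter> \<Inter>(E - {J}) \<noteq> supported U"
    by (elim exE conjE) (rule that)
  have dec: "irredundant_irreducible_decomposition (supported U) E"
    unfolding irredundant_irreducible_decomposition_def
  proof (intro conjI ballI)
    show "finite E" using E(1) \<open>finite ?D\<close> by (rule finite_subset)
    fix J assume "J \<in> E"
    then obtain b where "J = m_pow b" using E(1) by blast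
    then show "monomial_ideal J" "irreducible_ideal S_ring J"
      by (simp_all only: monomial_ideal_m_pow irreducible_m_pow)
  qed (use E in auto)
  have "Irr (supported U) = E"
    unfolding Irr_def
  proof (rule the_equality)
    fix D :: "('k, 'n) laurent set set"
    assume "irredundant_irreducible_decomposition (supported U) D"
    from irredundant_decomposition_subset[OF this dec] irredundant_decomposition_subset[OF dec this]
    show "D = E" by (rule subset_antisym)
  qed (rule dec)
  then show "Irr (supported U :: ('k, 'n) laurent set) \<subseteq> {m_pow b | b. 0 \<le> b \<and> b \<le> a}"
    and "polys \<inter> \<Inter>(Irr (supported U)) = (supported U :: ('k, 'n) laurent set)"
    using E by auto
qed


section \<open>Alexander duality\<close>

lemma shift_supported:
  "shift (supported U :: ('k::field, 'n::finite) laurent set) a = supported {c. a + c \<in> U}"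
proof
  show "shift (supported U) a \<subseteq> supported {c. a + c \<in> U}"
    by (fastforce simp: shift_def supported_def keys_monomial_mult)
  show "(supported {c. a + c \<in> U} :: ('k, 'n) laurent set) \<subseteq> shift (supported U) a"
  proof
    fix p :: "('k, 'n) laurent" assume p: "p \<in> supported {c. a + c \<in> U}"
    have "p = monomial (- a) * (monomial a * p)"
      by (simp add: mult.assoc[symmetric] monomial_add[symmetric]) (simp add: monomial_def)
    moreover have "monomial a * p \<in> supported U"
      using p by (auto simp: supported_def keys_monomial_mult)
    ultimately show "p \<in> shift (supported U) a" unfolding shift_def by blast
  qed
qed

lemma upward_nonneg_part:
  assumes "upward U = U"
  shows "upward {b. (\<chi> i. max (b $ i) 0) \<in> U} = {b. (\<chi> i. max (b $ i) 0) \<in> U}"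
proof (rule upward_absorb)
  fix c d assume c: "c \<in> {b. (\<chi> i. max (b $ i) 0) \<in> U}" "c \<le> d"
  have "(\<chi> i. max (c $ i) 0) \<le> (\<chi> i. max (d $ i) 0)"
    using c(2) by (simp add: less_eq_vec_def max.coboundedI1)
  then show "d \<in> {b. (\<chi> i. max (b $ i) 0) \<in> U}"
    using upward_closed[of "\<chi> i. max (c $ i) 0" U "\<chi> i. max (d $ i) 0"] assms c(1) by simp
qed

lemma cech_hull_supported:
  assumes "upward U = U"
  shows "cech_hull (supported U :: ('k::field, 'n::finite) laurent set) =
    supported {b. (\<chi> i. max (b $ i) 0) \<in> U}" (is "_ = supported ?V")
proof -
  have "upward ?V = ?V" by (rule upward_nonneg_part[OF assms])
  moreover have "{monomial b | b. (monomial (\<chi> i. max (b $ i) 0) :: ('k, 'n) laurent) \<in> supported U} =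
      (monomial ` ?V :: ('k, 'n) laurent set)" by auto
  ultimately show ?thesis by (simp only: cech_hull_def S_span_monomials)
qed

lemma T_dual_supported:
  assumes "upward U = U"
  shows "T_dual (supported U :: ('k::field, 'n::finite) laurent set) = supported {c. - c \<notin> U}" (is "_ = supported ?V")
proof -
  have "upward ?V = ?V"
  proof (rule upward_absorb)
    fix c d assume "c \<in> ?V" "c \<le> d"
    then show "d \<in> ?V" using upward_closed[of "- d" U "- c"] assms by (auto simp: less_eq_vec_def)
  qed
  moreover have "{monomial (- b) | b. (monomial b :: ('k, 'n) laurent) \<notin> supported U} =
      (monomial ` ?V :: ('k, 'n) laurent set)"
    by (auto simp: image_iff) (metis minus_minus)
  ultimately show ?thesis by (simp only: T_dual_def S_span_monomials)
qed

text \<open>The step where the two constructions meet: the left side is divisibility by a generator of \<open>I\<^sup>a\<close>, the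
right side is the condition that the \<open>T\<close>-dual and the Cech hull impose for a single component.\<close>
lemma flip_le_iff:
  assumes "0 \<le> c"
  shows "flip a b \<le> c \<longleftrightarrow> (\<chi> i. max ((a - c) $ i) 0) \<notin> power_exponents b"
proof -
  have "flip a b \<le> c \<longleftrightarrow> (\<forall>i. 1 \<le> b $ i \<longrightarrow> a $ i + 1 - b $ i \<le> c $ i)"
    using assms by (auto simp: flip_def less_eq_vec_def)
  also have "\<dots> \<longleftrightarrow> (\<chi> i. max ((a - c) $ i) 0) \<notin> power_exponents b"
  proof -
    have "a $ i + 1 - b $ i \<le> c $ i \<longleftrightarrow> \<not> b $ i \<le> max ((a - c) $ i) 0" if "1 \<le> b $ i" for i
      using that by auto
    then show ?thesis by (auto simp: power_exponents_def less_eq_vec_def)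
  qed
  finally show ?thesis .
qed

theorem theorem2p13:
  fixes I :: "('k::field, 'n::finite) laurent set" and a :: "int ^ 'n"
  assumes "CARD('n) \<ge> 2"
    and "monomial_ideal I" and "I \<noteq> polys"
    and "lcm_exponent I \<le> a"
  shows "alexander_dual I a = alexander_dual_cech I a"
proof -
  obtain U where U: "U \<subseteq> {c. 0 \<le> c}" "upward U = U" and I: "I = supported U"
    using assms(2) by (auto simp: monomial_ideal_iff)
  have Irr_sub: "Irr I \<subseteq> {m_pow b | b. 0 \<le> b \<and> b \<le> a}" and Irr_Int: "polys \<inter> \<Inter>(Irr I) = I"
    using Irr_decomposition[OF U] assms(4) by (simp_all add: I)
  let ?pos = "\<lambda>c. (\<chi> i. max ((a - c) $ i) 0) :: int ^ 'n"
  let ?G = "{flip a b | b. 0 \<le> b \<and> (m_pow b :: ('k, 'n) laurent set) \<in> Irr I}"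
  (* The bound b \<le> a keeps the exponents a_i + 1 - b_i nonnegative. *)
  have nonneg: "?G \<subseteq> {c. 0 \<le> c}"
  proof clarify
    fix b assume b: "0 \<le> b" "(m_pow b :: ('k, 'n) laurent set) \<in> Irr I"
    then obtain b' where "0 \<le> b'" "b' \<le> a" "(m_pow b :: ('k, 'n) laurent set) = m_pow b'"
      using Irr_sub by auto
    then have "b \<le> a" using power_exponents_inj[OF b(1)] by (auto simp: m_pow_eq_supported)
    then show "0 \<le> flip a b" by (auto simp: flip_def less_eq_vec_def intro: order_trans)
  qed
  have mem: "c \<in> upward ?G \<longleftrightarrow> ?pos c \<notin> U" if c: "0 \<le> c" for c
  proof -
    have "?pos c \<notin> U \<longleftrightarrow> (monomial (?pos c) :: ('k, 'n) laurent) \<notin> polys \<inter> \<Inter>(Irr I)"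
      unfolding Irr_Int unfolding I by simp
    also have "\<dots> \<longleftrightarrow> (\<exists>J\<in>Irr I. (monomial (?pos c) :: ('k, 'n) laurent) \<notin> J)"
      by (auto simp: monomial_in_polys_iff less_eq_vec_def)
    also have "\<dots> \<longleftrightarrow> (\<exists>b. 0 \<le> b \<and> (m_pow b :: ('k, 'n) laurent set) \<in> Irr I \<and>
        ?pos c \<notin> power_exponents b)"
    proof
      assume "\<exists>J\<in>Irr I. (monomial (?pos c) :: ('k, 'n) laurent) \<notin> J"
      then obtain J where J: "J \<in> Irr I" "(monomial (?pos c) :: ('k, 'n) laurent) \<notin> J" by blast
      then obtain b where "0 \<le> b" "J = m_pow b" using Irr_sub by blast
      then show "\<exists>b. 0 \<le> b \<and> (m_pow b :: ('k, 'n) laurent set) \<in> Irr I \<and> ?pos c \<notin> power_exponents b"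
        using J by (auto simp: m_pow_eq_supported)
    next
      assume "\<exists>b. 0 \<le> b \<and> (m_pow b :: ('k, 'n) laurent set) \<in> Irr I \<and> ?pos c \<notin> power_exponents b"
      then show "\<exists>J\<in>Irr I. (monomial (?pos c) :: ('k, 'n) laurent) \<notin> J"
        by (metis m_pow_eq_supported monomial_in_supported_iff)
    qed
    also have "\<dots> \<longleftrightarrow> c \<in> upward ?G"
      unfolding upward_def by (auto simp: flip_le_iff[OF c])
    finally show ?thesis by blast
  qed
  have "alexander_dual I a = supported (upward ?G)"
    unfolding alexander_dual_def by (rule genideal_monomials[OF nonneg])
  also have "upward ?G = {c. 0 \<le> c \<and> ?pos c \<notin> U}"
  proof (rule Set.set_eqI)
    fix c
    show "c \<in> upward ?G \<longleftrightarrow> c \<in> {c. 0 \<le> c \<and> ?pos c \<notin> U}"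
      using mem[of c] subsetD[OF upward_nonneg[OF nonneg], of c] by (cases "0 \<le> c") auto
  qed
  also have "supported \<dots> = alexander_dual_cech I a"
  proof -
    let ?V = "{b. (\<chi> i. max (b $ i) 0) \<in> U} :: (int ^ 'n) set"
    have "alexander_dual_cech I a = supported {c. - (- a + c) \<notin> ?V} \<inter> supported {c. 0 \<le> c}"
      by (simp add: alexander_dual_cech_def I cech_hull_supported[OF U(2)] 
          T_dual_supported[OF upward_nonneg_part[OF U(2)]]
          shift_supported polys_eq_supported)
    also have "\<dots> = supported {c. 0 \<le> c \<and> ?pos c \<notin> U}"
      unfolding supported_Int by (rule arg_cong[of _ _ supported]) auto
    finally show ?thesis by simp
  qed
  finally show ?thesis .
qed

end
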